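(* Let $$\phi_0=(p_0\wedge p_1)\vee(\neg p_0\wedge\neg p_1),\quad \phi_1=(p_0\wedge p_3)\vee(\neg p_0\wedge\neg p_3),$$ $$\phi_2=(p_1\wedge p_2)\vee(\neg p_1\wedge\neg p_2),\quad \phi_3=(\neg p_2\wedge p_3)\vee(p_2\wedge\neg p_3),$$ where $p_0,p_1,p_2,p_3$ are distinct proposition symbols. Then the normal formula $\sum_{j<4}\phi_j\leq3$ of quantum team logic $\mathrm{QTL}$ is not a validity of $\mathrm{QTL}$; indeed the normal formula $\sum_{j<4}\phi_j\geq 3+\frac14$ is satisfiable in $\mathrm{QTL}$, and even the normal formula $\sum_{j<4}\phi_j=4$ is satisfiable in $\mathrm{QTL}$.
   Context: **Comparing families of sets.** For families $\mathcal{U},\mathcal{U}'$ of sets, $\mathcal{U}\leq\mathcal{U}'$ means that every $U\in\mathcal{U}$ is contained in some $U'\in\mathcal{U}'$. **Quantum teams.** Let $\Omega$ be a finite set and $(Q_i)_{i\in\Omega}$ a sequence of finite non-empty sets of proposition symbols. A quantum team on $(Q_i)_{i\in\Omega}$ is a pair $X=(\Omega,\tau)$ such that each $\tau(i)$ is a truth-value assignment $Q_i\to\{0,1\}$. Its support is $\mathrm{Sp}(X)=\{Q_i:i\in\Omega\}$. For a finite set $U$ of proposition symbols let $\Omega_U=\{i\in\Omega:U\subseteq Q_i\}$. If $\Omega_U\neq\emptyset$ and all proposition symbols of the propositional formula $\phi$ lie in $U$, let $[\phi]_{X,U}=|\{i\in\Omega_U:\tau(i)(\phi)=1\}|/|\Omega_U|$.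 **QTL.** Atomic formulas are $\sum_{j<k}a_j(\phi_j;V_j)\geq c$ with $k\geq1$, $a_j,c\in\mathbb{Z}$, $\phi_j$ propositional formulas and $V_j$ finite sets of proposition symbols containing $\mathrm{Var}(\phi_j)$ (the proposition symbols of $\phi_j$); formulas are closed under $\neg$ and $\wedge$. Rational constants are allowed as abbreviations obtained by clearing denominators; $t\leq c$ abbreviates $-t\geq-c$, and $t=c$ abbreviates $(t\geq c)\wedge(t\leq c)$. The support $\mathrm{Sp}(\alpha)$ is the set of all $V_j$ occurring in $\alpha$. A formula is normal if $V_j=\mathrm{Var}(\phi_j)$ for all its components $(\phi_j;V_j)$; normal formulas are written omitting the supports $V_j$. **Semantics.** For a quantum team $X$ with $\mathrm{Sp}(\alpha)\leq\mathrm{Sp}(X)$: $X\models\sum_{j<k}a_j(\phi_j;V_j)\geq c$ iff $\sum_{j<k}a_j[\phi_j]_{X,V_j}\geq c$; $X\models\neg\alpha$ iff $X\not\models\alpha$; $X\models\alpha\wedge\beta$ iff $X\models\alpha$ and $X\models\beta$. $\alpha$ is satisfiable if $X\models\alpha$ for some quantum team $X$ with $\mathrm{Sp}(\alpha)\leq\mathrm{Sp}(X)$, and a validity if $X\models\alpha$ for all such $X$. *)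

theory Defs
  imports Complex_Main "HOL-Library.Countable_Set"
begin

section \<open>Propositional formulas\<close>

datatype 'p pform =
    PAtom 'p
  | PNeg "'p pform"  (\<open>\<^bold>\<not> _\<close> [40] 40)
  | PConj "'p pform" "'p pform"  (infixr \<open>\<^bold>\<and>\<close> 35)
  | PDisj "'p pform" "'p pform"  (infixr \<open>\<^bold>\<or>\<close> 30)

primrec vars :: "'p pform \<Rightarrow> 'p set" where
  "vars (PAtom p) = {p}"
| "vars (\<^bold>\<not> \<phi>) = vars \<phi>"
| "vars (\<phi> \<^bold>\<and> \<psi>) = vars \<phi> \<union> vars \<psi>"
| "vars (\<phi> \<^bold>\<or> \<psi>) = vars \<phi> \<union> vars \<psi>"

text \<open>A truth-value assignment on a set \<open>Q\<close> is a partial map with domain \<open>Q\<close>. The value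
  of a formula is meaningful only if its symbols lie in this domain.\<close>

primrec peval :: "('p \<rightharpoonup> bool) \<Rightarrow> 'p pform \<Rightarrow> bool" where
  "peval s (PAtom p) \<longleftrightarrow> s p = Some True"
| "peval s (\<^bold>\<not> \<phi>) \<longleftrightarrow> \<not> peval s \<phi>"
| "peval s (\<phi> \<^bold>\<and> \<psi>) \<longleftrightarrow> peval s \<phi> \<and> peval s \<psi>"
| "peval s (\<phi> \<^bold>\<or> \<psi>) \<longleftrightarrow> peval s \<phi> \<or> peval s \<psi>"


section \<open>Quantum teams\<close>

text \<open>A team is a pair \<open>(\<Omega>, \<tau>)\<close>. The sets \<open>Q\<^sub>i\<close> are recovered as \<open>dom (\<tau> i)\<close>
  for \<open>i \<in> \<Omega>\<close>; values of \<open>\<tau>\<close> outside \<open>\<Omega>\<close> are irrelevant.\<close>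

type_synonym ('i, 'p) team = "'i set \<times> ('i \<Rightarrow> 'p \<rightharpoonup> bool)"

definition quantum_team :: "('i, 'p) team \<Rightarrow> bool" where
  "quantum_team = (\<lambda>(\<Omega>, \<tau>). finite \<Omega> \<and> (\<forall>i\<in>\<Omega>. finite (dom (\<tau> i)) \<and> dom (\<tau> i) \<noteq> {}))"

definition team_support :: "('i, 'p) team \<Rightarrow> 'p set set" where
  "team_support = (\<lambda>(\<Omega>, \<tau>). (\<lambda>i. dom (\<tau> i)) ` \<Omega>)"

definition family_le :: "'p set set \<Rightarrow> 'p set set \<Rightarrow> bool"  (infix \<open>\<preceq>\<close> 50) where
  "\<U> \<preceq> \<U>' \<longleftrightarrow> (\<forall>U\<in>\<U>. \<exists>U'\<in>\<U>'. U \<subseteq> U')"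

definition indices_over :: "('i, 'p) team \<Rightarrow> 'p set \<Rightarrow> 'i set" where
  "indices_over = (\<lambda>(\<Omega>, \<tau>) U. {i\<in>\<Omega>. U \<subseteq> dom (\<tau> i)})"

text \<open>Only meaningful if \<open>indices_over X U \<noteq> {}\<close> and \<open>vars \<phi> \<subseteq> U\<close>.\<close>

definition prob :: "('i, 'p) team \<Rightarrow> 'p set \<Rightarrow> 'p pform \<Rightarrow> rat" where
  "prob X U \<phi> = of_nat (card {i \<in> indices_over X U. peval (snd X i) \<phi>})
     / of_nat (card (indices_over X U))"


section \<open>Quantum team logic\<close>

text \<open>A term \<open>\<Sum>j<k. a\<^sub>j (\<phi>\<^sub>j; V\<^sub>j)\<close> is the list of its triples \<open>(a\<^sub>j, \<phi>\<^sub>j, V\<^sub>j)\<close>.\<close>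

type_synonym 'p qterm = "(int \<times> 'p pform \<times> 'p set) list"

datatype 'p qtl =
    QGeq "'p qterm" int
  | QNeg "'p qtl"
  | QConj "'p qtl" "'p qtl"

primrec qtl_formula :: "'p qtl \<Rightarrow> bool" where
  "qtl_formula (QGeq t c) \<longleftrightarrow> t \<noteq> [] \<and> (\<forall>(a, \<phi>, V)\<in>set t. finite V \<and> vars \<phi> \<subseteq> V)"
| "qtl_formula (QNeg \<alpha>) \<longleftrightarrow> qtl_formula \<alpha>"
| "qtl_formula (QConj \<alpha> \<beta>) \<longleftrightarrow> qtl_formula \<alpha> \<and> qtl_formula \<beta>"

primrec normal :: "'p qtl \<Rightarrow> bool" where
  "normal (QGeq t c) \<longleftrightarrow> (\<forall>(a, \<phi>, V)\<in>set t. V = vars \<phi>)"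
| "normal (QNeg \<alpha>) \<longleftrightarrow> normal \<alpha>"
| "normal (QConj \<alpha> \<beta>) \<longleftrightarrow> normal \<alpha> \<and> normal \<beta>"

primrec support :: "'p qtl \<Rightarrow> 'p set set" where
  "support (QGeq t c) = (\<lambda>(a, \<phi>, V). V) ` set t"
| "support (QNeg \<alpha>) = support \<alpha>"
| "support (QConj \<alpha> \<beta>) = support \<alpha> \<union> support \<beta>"

definition term_value :: "('i, 'p) team \<Rightarrow> 'p qterm \<Rightarrow> rat" where
  "term_value X t = (\<Sum>(a, \<phi>, V)\<leftarrow>t. of_int a * prob X V \<phi>)"

text \<open>Only meaningful if \<open>support \<alpha> \<preceq> team_support X\<close>.\<close>

primrec sat :: "('i, 'p) team \<Rightarrow> 'p qtl \<Rightarrow> bool" where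
  "sat X (QGeq t c) \<longleftrightarrow> term_value X t \<ge> of_int c"
| "sat X (QNeg \<alpha>) \<longleftrightarrow> \<not> sat X \<alpha>"
| "sat X (QConj \<alpha> \<beta>) \<longleftrightarrow> sat X \<alpha> \<and> sat X \<beta>"

text \<open>HOL cannot quantify over the type of indices, so index sets range over the finite sets
  of naturals. This is no restriction, by lemma \<open>nat_indices\<close> below.\<close>

definition satisfiable :: "'p qtl \<Rightarrow> bool" where
  "satisfiable \<alpha> \<longleftrightarrow>
     (\<exists>X :: (nat, 'p) team. quantum_team X \<and> support \<alpha> \<preceq> team_support X \<and> sat X \<alpha>)"

definition validity :: "'p qtl \<Rightarrow> bool" where
  "validity \<alpha> \<longleftrightarrow>
     (\<forall>X :: (nat, 'p) team. quantum_team X \<and> support \<alpha> \<preceq> team_support X \<longrightarrow> sat X \<alpha>)"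

lemma nat_indices:
  fixes X :: "('i, 'p) team"
  assumes "quantum_team X"
  shows "\<exists>Y :: (nat, 'p) team. quantum_team Y \<and> team_support Y = team_support X
           \<and> (\<forall>\<alpha>. sat Y \<alpha> \<longleftrightarrow> sat X \<alpha>)"
proof -
  obtain \<Omega> \<tau> where X: "X = (\<Omega>, \<tau>)" by (cases X)
  have fin: "finite \<Omega>" using assms by (simp add: X quantum_team_def)
  then obtain f :: "'i \<Rightarrow> nat" where f: "inj_on f \<Omega>"
    using countable_finite countableE by metis
  define Y where "Y = (f ` \<Omega>, \<lambda>n. \<tau> (inv_into \<Omega> f n))"
  have inv: "inv_into \<Omega> f (f i) = i" if "i \<in> \<Omega>" for i
    using f that by simp
  have qt: "quantum_team Y"
    using assms inv by (auto simp: X Y_def quantum_team_def)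
  have sp: "team_support Y = team_support X"
    by (simp add: X Y_def team_support_def image_image inv cong: image_cong)
  have ind: "indices_over Y U = f ` indices_over X U" for U
    by (auto simp: X Y_def indices_over_def inv)
  have ind': "{n \<in> indices_over Y U. peval (snd Y n) \<phi>}
      = f ` {i \<in> indices_over X U. peval (snd X i) \<phi>}" for U \<phi>
    by (auto simp: X Y_def indices_over_def inv)
  have "inj_on f (indices_over X U)" for U
    by (rule inj_on_subset[OF f]) (auto simp: X indices_over_def)
  moreover have "inj_on f {i \<in> indices_over X U. peval (snd X i) \<phi>}" for U \<phi>
    by (rule inj_on_subset[OF f]) (auto simp: X indices_over_def)
  ultimately have "prob Y U \<phi> = prob X U \<phi>" for U \<phi>
    unfolding prob_def ind' by (simp add: ind card_image)
  hence "term_value Y t = term_value X t" for t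
    by (simp add: term_value_def)
  hence "sat Y \<alpha> \<longleftrightarrow> sat X \<alpha>" for \<alpha>
    by (induction \<alpha>) auto
  with qt sp show ?thesis by blast
qed


section \<open>Abbreviated formulas\<close>

text \<open>A rational bound \<open>n / d\<close> in lowest terms, \<open>d > 0\<close>, is cleared by multiplying the
  inequality by \<open>d\<close>.\<close>

definition scale_term :: "int \<Rightarrow> 'p qterm \<Rightarrow> 'p qterm" where
  "scale_term d t = map (\<lambda>(a, \<phi>, V). (d * a, \<phi>, V)) t"

definition geq :: "'p qterm \<Rightarrow> rat \<Rightarrow> 'p qtl" where
  "geq t c = (case quotient_of c of (n, d) \<Rightarrow> QGeq (scale_term d t) n)"

definition leq :: "'p qterm \<Rightarrow> rat \<Rightarrow> 'p qtl" where
  "leq t c = geq (scale_term (-1) t) (- c)"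

definition eq :: "'p qterm \<Rightarrow> rat \<Rightarrow> 'p qtl" where
  "eq t c = QConj (geq t c) (leq t c)"

lemma geq_of_int: "geq t (of_int c) = QGeq t c"
  by (simp add: geq_def scale_term_def case_prod_unfold)

lemma term_value_scale: "term_value X (scale_term d t) = of_int d * term_value X t"
  by (induction t) (auto simp: term_value_def scale_term_def algebra_simps)

lemma sat_geq: "sat X (geq t c) \<longleftrightarrow> term_value X t \<ge> c"
proof -
  obtain n d where nd: "quotient_of c = (n, d)" by (cases "quotient_of c")
  then have d: "d > 0" and "c = of_int n / of_int d"
    by (auto simp: quotient_of_div quotient_of_denom_pos)
  then have "of_int n = of_int d * c" by simp
  with d show ?thesis
    by (simp add: geq_def nd term_value_scale)
qed

text \<open>The sum \<open>\<Sum>j<k. \<phi>\<^sub>j\<close> with the supports left implicit, as in normal formulas.\<close>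

definition normal_sum :: "'p pform list \<Rightarrow> 'p qterm" where
  "normal_sum \<phi>s = map (\<lambda>\<phi>. (1, \<phi>, vars \<phi>)) \<phi>s"

end

theory Submission
  imports Defs
begin

text \<open>All four formulas can have probability 1 at once, because the edges \<open>{p0, p1}\<close>,
  \<open>{p0, p3}\<close>, \<open>{p1, p2}\<close>, \<open>{p2, p3}\<close> of the 4-cycle are measured by four different members of
  a quantum team. Each member satisfies its own formula, although no single assignment to
  \<open>p0, \<dots>, p3\<close> satisfies all four.\<close>

text \<open>Clearing denominators changes only the coefficients and the bound, while
  well-formedness, normality and support look only at the formulas and sets listed in
  \<open>t\<close>. The bound 0 on the right is a mere representative.\<close>

lemma qtl_formula_geq [simp]: "qtl_formula (geq t c) \<longleftrightarrow> qtl_formula (QGeq t 0)"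
  by (auto simp: geq_def scale_term_def split: prod.splits)

lemma normal_geq [simp]: "normal (geq t c) \<longleftrightarrow> normal (QGeq t 0)"
  by (auto simp: geq_def scale_term_def split: prod.splits)

lemma support_geq [simp]: "support (geq t c) = support (QGeq t 0)"
  by (force simp: geq_def scale_term_def split: prod.splits)

lemma qtl_formula_leq [simp]: "qtl_formula (leq t c) \<longleftrightarrow> qtl_formula (QGeq t 0)"
  by (auto simp: leq_def scale_term_def)

lemma normal_leq [simp]: "normal (leq t c) \<longleftrightarrow> normal (QGeq t 0)"
  by (auto simp: leq_def scale_term_def)

lemma support_leq [simp]: "support (leq t c) = support (QGeq t 0)"
  by (force simp: leq_def scale_term_def)

lemma sat_leq: "sat X (leq t c) \<longleftrightarrow> term_value X t \<le> c"
  by (simp add: leq_def sat_geq term_value_scale)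

lemma qtl_formula_normal_sum: "qtl_formula (QGeq (normal_sum \<phi>s) c) \<longleftrightarrow> \<phi>s \<noteq> []"
proof -
  \<comment> \<open>The supports of a normal sum are the sets \<open>vars \<phi>\<close>, and QTL
    demands finite supports.\<close>
  have "finite (vars \<phi>)" for \<phi> :: "'a pform"
    by (induction \<phi>) auto
  then show ?thesis
    by (auto simp: normal_sum_def)
qed

lemma normal_normal_sum: "normal (QGeq (normal_sum \<phi>s) c)"
  by (auto simp: normal_sum_def)

text \<open>Numerator and denominator count the same set. It must be finite and nonempty, since
  otherwise its \<open>card\<close> is 0 and the quotient would be 0 / 0 = 0.\<close>

lemma prob_eq_1:
  assumes "quantum_team X" "indices_over X U \<noteq> {}"
    and "\<And>i. i \<in> indices_over X U \<Longrightarrow> peval (snd X i) \<phi>"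
  shows "prob X U \<phi> = 1"
proof -
  have "finite (indices_over X U)"
    using assms(1) by (auto simp: quantum_team_def indices_over_def split: prod.splits)
  moreover have "{i \<in> indices_over X U. peval (snd X i) \<phi>} = indices_over X U"
    using assms(3) by blast
  ultimately show ?thesis
    using assms(2) by (simp add: prob_def)
qed

theorem mainTheorem3:
  fixes p0 p1 p2 p3 :: 'p
    and \<phi>0 \<phi>1 \<phi>2 \<phi>3 :: "'p pform"
    and t :: "'p qterm"
  assumes "distinct [p0, p1, p2, p3]"
    and "\<phi>0 = ((PAtom p0 \<^bold>\<and> PAtom p1) \<^bold>\<or> (\<^bold>\<not> PAtom p0 \<^bold>\<and> \<^bold>\<not> PAtom p1))"
    and "\<phi>1 = ((PAtom p0 \<^bold>\<and> PAtom p3) \<^bold>\<or> (\<^bold>\<not> PAtom p0 \<^bold>\<and> \<^bold>\<not> PAtom p3))"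
    and "\<phi>2 = ((PAtom p1 \<^bold>\<and> PAtom p2) \<^bold>\<or> (\<^bold>\<not> PAtom p1 \<^bold>\<and> \<^bold>\<not> PAtom p2))"
    and "\<phi>3 = ((\<^bold>\<not> PAtom p2 \<^bold>\<and> PAtom p3) \<^bold>\<or> (PAtom p2 \<^bold>\<and> \<^bold>\<not> PAtom p3))"
    and "t = normal_sum [\<phi>0, \<phi>1, \<phi>2, \<phi>3]"
  shows "qtl_formula (leq t 3) \<and> normal (leq t 3) \<and> \<not> validity (leq t 3)
    \<and> qtl_formula (geq t (3 + 1/4)) \<and> normal (geq t (3 + 1/4)) \<and> satisfiable (geq t (3 + 1/4))
    \<and> qtl_formula (eq t 4) \<and> normal (eq t 4) \<and> satisfiable (eq t 4)"
proof -
  \<comment> \<open>The domain of member i is the i-th edge. Its values agree on the first three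
    edges and differ on the last, because \<open>\<phi>3\<close> is an exclusive or.\<close>
  define \<tau> :: "nat \<Rightarrow> 'p \<rightharpoonup> bool" where
    "\<tau> = (\<lambda>_. Map.empty)(0 := [p0 \<mapsto> True, p1 \<mapsto> True], 1 := [p0 \<mapsto> True, p3 \<mapsto> True],
       2 := [p1 \<mapsto> True, p2 \<mapsto> True], 3 := [p2 \<mapsto> False, p3 \<mapsto> True])"
  define X where "X = ({0, 1, 2, 3 :: nat}, \<tau>)"
  note distinct = assms(1)[simplified]
  note formulas = assms(2-5)
  have team: "quantum_team X"
    by (simp add: quantum_team_def X_def \<tau>_def)
  have supp: "support (QGeq t 0) \<preceq> team_support X"
    by (auto simp: assms(6) formulas normal_sum_def family_le_def team_support_def X_def \<tau>_def)
  \<comment> \<open>As the symbols are distinct, no edge lies inside another, so each probability is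
    computed from one member alone.\<close>
  have idx: "indices_over X (vars \<phi>0) = {0}" "indices_over X (vars \<phi>1) = {1}"
      "indices_over X (vars \<phi>2) = {2}" "indices_over X (vars \<phi>3) = {3}"
    using distinct by (auto simp: indices_over_def X_def \<tau>_def formulas)
  have "prob X (vars \<phi>0) \<phi>0 = 1" "prob X (vars \<phi>1) \<phi>1 = 1"
      "prob X (vars \<phi>2) \<phi>2 = 1" "prob X (vars \<phi>3) \<phi>3 = 1"
    by (rule prob_eq_1[OF team]; use distinct in \<open>simp add: idx\<close>;
        use distinct in \<open>simp add: X_def \<tau>_def formulas\<close>)+
  \<comment> \<open>This one value settles all three claims: 4 exceeds 3, is at least 3 + 1/4, and
    equals 4.\<close>
  then have val: "term_value X t = 4"
    by (simp add: term_value_def assms(6) normal_sum_def)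
  have "\<not> validity (leq t 3)"
    unfolding validity_def not_all
    by (rule exI[of _ X]) (use team supp val in \<open>simp add: sat_leq del: support.simps(1)\<close>)
  moreover have "satisfiable (geq t (3 + 1/4))"
    unfolding satisfiable_def
    by (rule exI[of _ X]) (use team supp val in \<open>simp add: sat_geq del: support.simps(1)\<close>)
  moreover have "satisfiable (eq t 4)"
    unfolding satisfiable_def
    by (rule exI[of _ X])
      (use team supp val in \<open>simp add: eq_def sat_geq sat_leq del: support.simps(1)\<close>)
  moreover have "qtl_formula (QGeq t 0)" "normal (QGeq t 0)"
    unfolding assms(6) by (simp_all only: qtl_formula_normal_sum normal_normal_sum) simp
  ultimately show ?thesis
    by (simp add: eq_def del: qtl_formula.simps(1) normal.simps(1))
qed

end
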